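(* Let $p$ be a prime number, let $G=C_p$ be the cyclic group of order $p$ with generator $u$, and let $\chi_0,\ldots,\chi_{p-1}$ be the irreducible complex characters of $G$, where $\chi_x(u^a)=\omega^{ax}$ with $\omega=e^{2\pi i/p}$. Let $f$ be a bijection on the set $\{0,1,\ldots,p-1\}$, and let $I_f:\mathcal{R}(G)\longrightarrow\mathcal{R}(G)$ be the isometry defined on the basis by $I_f(\chi_x)=\chi_{f(x)}$ for $x=0,1,\ldots,p-1$. Then $I_f$ is a perfect isometry if and only if $f$ is a linear bijection.
   Context: $\mathcal{R}(G)$ denotes the free abelian group generated by the set $\mathrm{Irr}(G)$ of irreducible complex characters of $G$, regarded as lying in the space $CF(G)$ of complex-valued class functions of $G$ with the standard inner product of group characters. For a linear map $I:\mathcal{R}(G)\to\mathcal{R}(G)$, define the generalized character $\mu_I$ of $G\times G$ by \[\mu_I(g,h)=\sum_{\chi\in\mathrm{Irr}(G)}I(\chi)(g)\,\chi(h)\quad\text{for all } g,h\in G.\] An isometry $I:\mathcal{R}(G)\to\mathcal{R}(G)$ is a perfect isometry if $\mu_I$ satisfies: (i) (Integrality) for all $g,h\in G$, the number $\mu_I(g,h)/p$ is an algebraic integer; (ii) (Separation) if $\mu_I(g,h)\neq 0$, then either both $g$ and $h$ are the identity element or both are not. The set $\{0,1,\ldots,p-1\}$ is identified with the ring $\mathbb{Z}_p$ of integers modulo $p$. A bijection $f$ of this set is linear if there exist $\alpha,\beta\in\mathbb{Z}_p$ such that $f(x)\equiv\alpha x+\beta \pmod p$ for all $x$. *)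

theory Defs
  imports
    Complex_Main
    "HOL-Algebra.Generated_Groups"
    "HOL-Computational_Algebra.Polynomial"
    "HOL-Number_Theory.Cong"
    "Jordan_Normal_Form.VS_Connect"
begin

text \<open>Complex-valued functions on a group \<open>G\<close> are represented by functions on the ambient type
  that vanish outside \<^term>\<open>carrier G\<close>, so that equality of functions is equality on \<open>G\<close>.\<close>

definition class_functions :: "('a, 'b) monoid_scheme \<Rightarrow> ('a \<Rightarrow> complex) set" where
  "class_functions G =
     {\<phi>. (\<forall>g\<in>carrier G. \<forall>h\<in>carrier G. \<phi> (h \<otimes>\<^bsub>G\<^esub> g \<otimes>\<^bsub>G\<^esub> inv\<^bsub>G\<^esub> h) = \<phi> g) \<and>
         (\<forall>g. g \<notin> carrier G \<longrightarrow> \<phi> g = 0)}"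

definition char_inner :: "('a, 'b) monoid_scheme \<Rightarrow> ('a \<Rightarrow> complex) \<Rightarrow> ('a \<Rightarrow> complex) \<Rightarrow> complex" where
  "char_inner G \<phi> \<psi> = (\<Sum>g\<in>carrier G. \<phi> g * cnj (\<psi> g)) / of_nat (Coset.order G)"

definition GL_mat :: "nat \<Rightarrow> complex mat monoid" where
  "GL_mat n = units_of (ring_mat TYPE(complex) n ())"

definition irreducible_rep :: "('a, 'b) monoid_scheme \<Rightarrow> nat \<Rightarrow> ('a \<Rightarrow> complex mat) \<Rightarrow> bool" where
  "irreducible_rep G n \<rho> \<longleftrightarrow>
     n > 0 \<and> \<rho> \<in> hom G (GL_mat n) \<and>
     (\<forall>W. VectorSpace.subspace class_ring W (module_vec TYPE(complex) n) \<and>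
          (\<forall>g\<in>carrier G. \<forall>w\<in>W. \<rho> g *\<^sub>v w \<in> W) \<longrightarrow>
          W = {0\<^sub>v n} \<or> W = carrier_vec n)"

definition rep_character ::
    "('a, 'b) monoid_scheme \<Rightarrow> nat \<Rightarrow> ('a \<Rightarrow> complex mat) \<Rightarrow> 'a \<Rightarrow> complex" where
  "rep_character G n \<rho> = (\<lambda>g. if g \<in> carrier G then \<Sum>i<n. \<rho> g $$ (i, i) else 0)"

definition Irr :: "('a, 'b) monoid_scheme \<Rightarrow> ('a \<Rightarrow> complex) set" where
  "Irr G = {rep_character G n \<rho> | n \<rho>. irreducible_rep G n \<rho>}"

text \<open>The integral span of \<^term>\<open>Irr G\<close>, meant for finite \<open>G\<close>, where \<^term>\<open>Irr G\<close> is finite and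
  linearly independent; the span is then the free abelian group on \<^term>\<open>Irr G\<close>.\<close>

definition character_ring :: "('a, 'b) monoid_scheme \<Rightarrow> ('a \<Rightarrow> complex) set" where
  "character_ring G = range (\<lambda>c :: ('a \<Rightarrow> complex) \<Rightarrow> int. \<lambda>g. \<Sum>\<chi>\<in>Irr G. of_int (c \<chi>) * \<chi> g)"

text \<open>Linearity means \<open>\<int>\<close>-linearity, which for maps of abelian groups is additivity.\<close>

definition linear_on_characters ::
    "('a, 'b) monoid_scheme \<Rightarrow> (('a \<Rightarrow> complex) \<Rightarrow> ('a \<Rightarrow> complex)) \<Rightarrow> bool" where
  "linear_on_characters G I \<longleftrightarrow>
     I \<in> character_ring G \<rightarrow> character_ring G \<and>
     (\<forall>\<phi>\<in>character_ring G. \<forall>\<psi>\<in>character_ring G.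
        I (\<lambda>g. \<phi> g + \<psi> g) = (\<lambda>g. I \<phi> g + I \<psi> g))"

definition character_isometry ::
    "('a, 'b) monoid_scheme \<Rightarrow> (('a \<Rightarrow> complex) \<Rightarrow> ('a \<Rightarrow> complex)) \<Rightarrow> bool" where
  "character_isometry G I \<longleftrightarrow>
     linear_on_characters G I \<and>
     (\<forall>\<phi>\<in>character_ring G. \<forall>\<psi>\<in>character_ring G.
        char_inner G (I \<phi>) (I \<psi>) = char_inner G \<phi> \<psi>)"

definition mu ::
    "('a, 'b) monoid_scheme \<Rightarrow> (('a \<Rightarrow> complex) \<Rightarrow> ('a \<Rightarrow> complex)) \<Rightarrow> 'a \<Rightarrow> 'a \<Rightarrow> complex" where
  "mu G I g h = (\<Sum>\<chi>\<in>Irr G. I \<chi> g * \<chi> h)"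

text \<open>This is the form that perfectness takes for a group of prime order \<open>p\<close>: every centralizer
  has order \<open>p\<close> and the identity is the only \<open>p\<close>-regular element.\<close>

definition perfect_isometry ::
    "nat \<Rightarrow> ('a, 'b) monoid_scheme \<Rightarrow> (('a \<Rightarrow> complex) \<Rightarrow> ('a \<Rightarrow> complex)) \<Rightarrow> bool" where
  "perfect_isometry p G I \<longleftrightarrow>
     character_isometry G I \<and>
     (\<forall>g\<in>carrier G. \<forall>h\<in>carrier G. algebraic_int (mu G I g h / of_nat p)) \<and>
     (\<forall>g\<in>carrier G. \<forall>h\<in>carrier G. mu G I g h \<noteq> 0 \<longrightarrow> (g = \<one>\<^bsub>G\<^esub> \<longleftrightarrow> h = \<one>\<^bsub>G\<^esub>))"

definition linear_bijection :: "nat \<Rightarrow> (nat \<Rightarrow> nat) \<Rightarrow> bool" where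
  "linear_bijection p f \<longleftrightarrow>
     bij_betw f {0..<p} {0..<p} \<and>
     (\<exists>\<alpha>\<in>{0..<p}. \<exists>\<beta>\<in>{0..<p}. \<forall>x\<in>{0..<p}. [f x = \<alpha> * x + \<beta>] (mod p))"

end

theory Submission
  imports
    Defs
    "Jordan_Normal_Form.Spectral_Radius"
    "HOL-Algebra.Multiplicative_Group"
begin

text \<open>
  Write \<open>\<omega> = exp (2 * pi * \<i> / p)\<close>.  Since \<open>G\<close> is cyclic, \<^term>\<open>Irr G\<close> consists of the \<open>p\<close> characters
  \<open>chi x\<close> (lemma \<open>Irr_eq\<close>), so that
  \<open>mu G I (u^a) (u^b) = (\<Sum>x<p. \<omega> ^ (a * f x + b * x))\<close>, and \<open>I\<close> is an isometry because it
  permutes an orthonormal family.  What remains is a question about these exponential sums.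

  If \<open>f x = \<alpha> x + \<beta>\<close> modulo \<open>p\<close>, the sum is geometric: it is \<open>p \<omega> ^ (a \<beta>)\<close> when \<open>p\<close> divides
  \<open>a \<alpha> + b\<close>, and \<open>0\<close> otherwise.  Integrality is then visible, and separation holds because
  \<open>\<alpha>\<close> is invertible modulo \<open>p\<close>.

  Conversely, integrality alone forces \<open>f\<close> to be affine.  Summing over all \<open>b\<close> shows that
  \<open>(\<Sum>x<p. \<omega> ^ (f x + b * x))\<close> is nonzero for at least one \<open>b\<close>.  Divided by \<open>p\<close>, this number is an
  average of roots of unity; replacing \<open>\<omega>\<close> by \<open>\<omega> ^ k\<close> gives its conjugates
  \<open>mu G I (u^k) (u^(k b)) / p\<close>, which are again averages of roots of unity, and algebraic integers by
  hypothesis.  A nonzero algebraic integer cannot have all its conjugates inside the open unit disc, so one of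
  these averages lies on the unit circle.  An average of unit vectors has norm \<open>1\<close> only if the
  vectors are all equal; hence \<open>f x + b x\<close> is constant modulo \<open>p\<close>
  (lemma \<open>exponents_cong_if_conjugates_divisible\<close>).

  The claim about the unit disc is proved with power sums.  With \<open>z k\<close> the squared norm of the \<open>k\<close>-th conjugate, the power sums
  \<open>(\<Sum>k\<in>{1..<p}. z k ^ m)\<close> are rational by orthogonality of the powers of \<open>\<omega>\<close>, and algebraic
  integers because these form a ring (lemmas \<open>algebraic_int_add\<close> and \<open>algebraic_int_mult\<close>).
  They are thus integers for every \<open>m\<close>, and positive because \<open>z 1\<close> is, whereas they would tend
  to \<open>0\<close> if all these \<open>z k\<close> were less than \<open>1\<close>.
\<close>

section \<open>The ring of algebraic integers\<close>

text \<open>The characteristic polynomial of an integer matrix is monic with integer coefficients, and it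
  annihilates the eigenvalues of the matrix.\<close>

lemma algebraic_int_if_integer_eigenvalue:
  fixes v :: "nat \<Rightarrow> 'a::field_char_0"
  assumes "i < n" "v i \<noteq> 0"
    and eq: "\<And>i. i < n \<Longrightarrow> x * v i = (\<Sum>j<n. of_int (A i j) * v j)"
  shows "algebraic_int x"
proof -
  define M where "M = mat n n (\<lambda>(i, j). A i j)"
  define N :: "'a mat" where "N = map_mat of_int M"
  have M: "M \<in> carrier_mat n n" and N: "N \<in> carrier_mat n n"
    by (simp_all add: M_def N_def)
  have "N *\<^sub>v vec n v = x \<cdot>\<^sub>v vec n v"
    by (rule eq_vecI) (auto simp: N_def M_def scalar_prod_def eq lessThan_atLeast0)
  moreover have "vec n v \<noteq> 0\<^sub>v n"
    using assms(1,2) by (metis index_vec index_zero_vec(1))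
  ultimately have "eigenvalue N x"
    using N by (auto simp: eigenvalue_def eigenvector_def intro!: exI[of _ "vec n v"])
  then have "poly (char_poly N) x = 0"
    using eigenvalue_root_char_poly[OF N] by simp
  moreover have "char_poly N = map_poly of_int (char_poly M)"
    unfolding N_def by (rule of_int_hom.char_poly_hom[OF M])
  moreover have "lead_coeff (char_poly M) = 1"
    using degree_monic_char_poly[OF M] by simp
  ultimately show ?thesis
    unfolding algebraic_int_altdef_ipoly by metis
qed

definition int_span :: "'a::ring_1 set \<Rightarrow> 'a set" where
  "int_span S = range (\<lambda>c :: 'a \<Rightarrow> int. \<Sum>s\<in>S. of_int (c s) * s)"

lemma int_spanI: "a = (\<Sum>s\<in>S. of_int (c s) * s) \<Longrightarrow> a \<in> int_span S"
  by (auto simp: int_span_def)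

lemma int_span_base:
  assumes "finite S" "s \<in> S"
  shows "s \<in> int_span S"
proof -
  have "(\<Sum>t\<in>S. of_int (if t = s then 1 else 0) * t) = (\<Sum>t\<in>S. if t = s then t else 0)"
    by (rule sum.cong) auto
  also have "\<dots> = s" using assms by simp
  finally have "s = (\<Sum>t\<in>S. of_int (if t = s then 1 else 0) * t)" ..
  then show ?thesis
    by (rule int_spanI)
qed

lemma int_span_0: "0 \<in> int_span S"
  by (rule int_spanI[where c = "\<lambda>_. 0"]) simp

lemma int_span_add: "a \<in> int_span S \<Longrightarrow> b \<in> int_span S \<Longrightarrow> a + b \<in> int_span S"
proof -
  assume "a \<in> int_span S" "b \<in> int_span S"
  then obtain c d where "a = (\<Sum>s\<in>S. of_int (c s) * s)" "b = (\<Sum>s\<in>S. of_int (d s) * s)"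
    unfolding int_span_def by blast
  then have "a + b = (\<Sum>s\<in>S. of_int (c s + d s) * s)"
    by (simp add: sum.distrib distrib_right)
  then show ?thesis
    by (rule int_spanI)
qed

lemma int_span_scale: "a \<in> int_span S \<Longrightarrow> of_int n * a \<in> int_span S"
proof -
  assume "a \<in> int_span S"
  then obtain c where "a = (\<Sum>s\<in>S. of_int (c s) * s)"
    unfolding int_span_def by blast
  then have "of_int n * a = (\<Sum>s\<in>S. of_int (n * c s) * s)"
    by (simp add: sum_distrib_left mult.assoc)
  then show ?thesis
    by (rule int_spanI)
qed

lemma int_span_sum: "(\<And>i. i \<in> B \<Longrightarrow> g i \<in> int_span S) \<Longrightarrow> sum g B \<in> int_span S"
  by (induction B rule: infinite_finite_induct) (auto intro: int_span_0 int_span_add)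

lemma int_span_mult_closed:
  fixes x :: "'a::comm_ring_1"
  assumes "\<And>s. s \<in> S \<Longrightarrow> x * s \<in> int_span S" and "a \<in> int_span S"
  shows "x * a \<in> int_span S"
proof -
  obtain c where "a = (\<Sum>s\<in>S. of_int (c s) * s)"
    using assms(2) unfolding int_span_def by blast
  then have "x * a = (\<Sum>s\<in>S. of_int (c s) * (x * s))"
    by (simp add: sum_distrib_left mult.left_commute)
  also have "\<dots> \<in> int_span S"
    by (intro int_span_sum int_span_scale assms(1))
  finally show ?thesis .
qed

text \<open>The determinant trick: multiplication by \<open>x\<close> acts on the generators \<open>S\<close> through an integer
  matrix, and the family of generators itself is an eigenvector of that matrix for the eigenvalue \<open>x\<close>.\<close>

lemma algebraic_int_if_stabilizes_int_span:
  fixes x :: "'a::field_char_0"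
  assumes "finite S" "s \<in> S" "s \<noteq> 0" and stable: "\<And>s. s \<in> S \<Longrightarrow> x * s \<in> int_span S"
  shows "algebraic_int x"
proof -
  obtain v where v: "bij_betw v {..<card S} S"
    using ex_bij_betw_nat_finite[OF \<open>finite S\<close>] by (metis lessThan_atLeast0)
  have "\<exists>c :: 'a \<Rightarrow> int. x * t = (\<Sum>s\<in>S. of_int (c s) * s)" if "t \<in> S" for t
    using stable[OF that] unfolding int_span_def by auto
  then obtain c :: "'a \<Rightarrow> 'a \<Rightarrow> int"
    where c: "\<And>t. t \<in> S \<Longrightarrow> x * t = (\<Sum>s\<in>S. of_int (c t s) * s)"
    by metis
  have "x * v i = (\<Sum>j<card S. of_int (c (v i) (v j)) * v j)" if "i < card S" for i
  proof -
    have "v i \<in> S" using v that by (auto simp: bij_betw_def)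
    then show ?thesis
      using sum.reindex_bij_betw[OF v, of "\<lambda>s. of_int (c (v i) s) * s"] c by simp
  qed
  moreover obtain i where "i < card S" "v i = s"
    using v \<open>s \<in> S\<close> by (metis bij_betw_iff_bijections lessThan_iff)
  ultimately show ?thesis
    using \<open>s \<noteq> 0\<close> algebraic_int_if_integer_eigenvalue[of i "card S" v x "\<lambda>i j. c (v i) (v j)"] by simp
qed

lemma algebraic_int_power_reduction:
  fixes x :: "'a::field_char_0"
  assumes "algebraic_int x"
  obtains n c where "n > 0" "x ^ n = (\<Sum>i<n. of_int (c i) * x ^ i)"
proof -
  obtain q :: "int poly" where q: "poly (map_poly of_int q) x = 0" "lead_coeff q = 1"
    using assms unfolding algebraic_int_altdef_ipoly by blast
  define n where "n = degree q"
  have "(\<Sum>i\<le>n. of_int (poly.coeff q i) * x ^ i) = 0"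
    using q(1) by (simp add: poly_altdef n_def coeff_map_poly degree_map_poly)
  then have eq: "(\<Sum>i<n. of_int (poly.coeff q i) * x ^ i) + x ^ n = 0"
    using q(2) by (simp add: n_def lessThan_Suc_atMost[symmetric])
  have "n > 0"
    using eq by (intro gr0I) simp
  moreover have "x ^ n = (\<Sum>i<n. of_int (- poly.coeff q i) * x ^ i)"
    using eq by (simp add: sum_negf eq_neg_iff_add_eq_0 add.commute)
  ultimately show ?thesis by (rule that)
qed

lemma power_mult_in_int_span:
  fixes x y :: "'a::field_char_0"
  assumes x: "x ^ n = (\<Sum>i<n. of_int (c i) * x ^ i)"
    and s: "i < n" "j < m"
  shows "x * (x ^ i * y ^ j) \<in> int_span ((\<lambda>(i, j). x ^ i * y ^ j) ` ({..<n} \<times> {..<m}))"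
    (is "_ \<in> int_span ?S")
proof -
  have mem: "x ^ i * y ^ j \<in> int_span ?S" if "i < n" "j < m" for i j
    using that by (intro int_span_base) auto
  show ?thesis
  proof (cases "Suc i < n")
    case True
    then show ?thesis using mem[of "Suc i" j] s by (simp add: mult.assoc)
  next
    case False
    then have "n = Suc i" using s by simp
    then have "x * (x ^ i * y ^ j) = x ^ n * y ^ j"
      by (simp add: mult.assoc)
    also have "\<dots> = (\<Sum>i<n. of_int (c i) * (x ^ i * y ^ j))"
      by (simp add: x sum_distrib_right mult.assoc)
    also have "\<dots> \<in> int_span ?S"
      using s by (intro int_span_sum int_span_scale mem) auto
    finally show ?thesis .
  qed
qed

text \<open>Both \<open>x\<close> and \<open>y\<close>, hence also \<open>x + y\<close> and \<open>x * y\<close>, stabilize the integral span of the monomials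
  \<open>x ^ i * y ^ j\<close> with exponents below the degrees of integral equations of \<open>x\<close> and \<open>y\<close>.\<close>

lemma
  fixes x y :: "'a::field_char_0"
  assumes "algebraic_int x" "algebraic_int y"
  shows algebraic_int_add: "algebraic_int (x + y)"
    and algebraic_int_mult: "algebraic_int (x * y)"
proof -
  obtain n c where n: "n > 0" "x ^ n = (\<Sum>i<n. of_int (c i) * x ^ i)"
    using algebraic_int_power_reduction[OF assms(1)] .
  obtain m d where m: "m > 0" "y ^ m = (\<Sum>i<m. of_int (d i) * y ^ i)"
    using algebraic_int_power_reduction[OF assms(2)] .
  define S where "S = (\<lambda>(i, j). x ^ i * y ^ j) ` ({..<n} \<times> {..<m})"
  \<comment> \<open>Exchanging the roles of \<open>x\<close> and \<open>y\<close> leaves \<open>S\<close> unchanged, so one lemma serves both.\<close>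
  have S_swap: "S = (\<lambda>(j, i). y ^ j * x ^ i) ` ({..<m} \<times> {..<n})"
    unfolding S_def by (force simp: mult.commute)
  have x_stable: "x * s \<in> int_span S" if "s \<in> S" for s
    using that power_mult_in_int_span[OF n(2)] unfolding S_def by auto
  have y_stable: "y * s \<in> int_span S" if "s \<in> S" for s
    using that power_mult_in_int_span[OF m(2)] unfolding S_swap by auto
  have fin: "finite S" and one: "1 \<in> S"
    using n(1) m(1) by (auto simp: S_def intro!: image_eqI[of _ _ "(0, 0)"])
  show "algebraic_int (x + y)"
  proof (rule algebraic_int_if_stabilizes_int_span[OF fin one])
    show "(x + y) * s \<in> int_span S" if "s \<in> S" for s
      using int_span_add[OF x_stable y_stable, OF that that] by (simp add: distrib_right)
  qed simp
  show "algebraic_int (x * y)"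
  proof (rule algebraic_int_if_stabilizes_int_span[OF fin one])
    show "x * y * s \<in> int_span S" if "s \<in> S" for s
      using int_span_mult_closed[OF x_stable y_stable, OF _ that] by (simp add: mult.assoc)
  qed simp
qed

lemma algebraic_int_sum:
  fixes g :: "'b \<Rightarrow> 'a::field_char_0"
  shows "(\<And>i. i \<in> B \<Longrightarrow> algebraic_int (g i)) \<Longrightarrow> algebraic_int (sum g B)"
  by (induction B rule: infinite_finite_induct) (auto intro: algebraic_int_add)

lemma algebraic_int_power:
  fixes x :: "'a::field_char_0"
  shows "algebraic_int x \<Longrightarrow> algebraic_int (x ^ n)"
  by (induction n) (auto intro: algebraic_int_mult int_imp_algebraic_int)

section \<open>Sums of roots of unity\<close>

locale primitive_root_of_unity =
  fixes p :: nat and \<omega> :: complex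
  assumes p_pos: "p > 0" and power_eq_1_iff_dvd: "\<omega> ^ k = 1 \<longleftrightarrow> p dvd k"
begin

lemma power_order [simp]: "\<omega> ^ p = 1"
  by (simp add: power_eq_1_iff_dvd)

lemma nonzero: "\<omega> \<noteq> 0"
  using power_order p_pos by (metis power_0_left not_gr0 zero_neq_one)

lemma norm_1 [simp]: "norm \<omega> = 1"
proof -
  have "norm \<omega> ^ p = 1" by (simp flip: norm_power)
  then show ?thesis using p_pos power_eq_imp_eq_base[of "norm \<omega>" p 1] by simp
qed

lemma cnj_power: "cnj (\<omega> ^ n) = \<omega> ^ ((p - 1) * n)"
proof -
  have "\<omega> ^ (p - 1) * \<omega> = 1"
    using power_order p_pos by (metis power_minus_mult)
  moreover have "cnj \<omega> * \<omega> = 1"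
    by (metis mult.commute complex_norm_square norm_1 of_real_1 power_one)
  ultimately have "cnj \<omega> = \<omega> ^ (p - 1)"
    using nonzero by (metis mult_right_cancel)
  then show ?thesis by (simp add: power_mult)
qed

lemma power_eq_iff_cong: "\<omega> ^ i = \<omega> ^ j \<longleftrightarrow> [i = j] (mod p)"
proof (induction i j rule: linorder_wlog)
  case (le i j)
  have "\<omega> ^ i = \<omega> ^ j \<longleftrightarrow> \<omega> ^ i * \<omega> ^ (j - i) = \<omega> ^ i * 1"
    using le by (auto simp flip: power_add)
  also have "\<dots> \<longleftrightarrow> p dvd (j - i)"
    using nonzero by (simp add: power_eq_1_iff_dvd)
  also have "\<dots> \<longleftrightarrow> [i = j] (mod p)"
    using le by (metis cong_altdef_nat cong_sym_eq)
  finally show ?case .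
qed (auto simp: cong_sym_eq)

lemma sum_powers: "(\<Sum>k<p. \<omega> ^ (k * j)) = (if p dvd j then of_nat p else 0)"
proof (cases "p dvd j")
  case True
  then have "\<omega> ^ (k * j) = 1" for k by (simp add: power_eq_1_iff_dvd)
  then show ?thesis using True by simp
next
  case False
  have "(\<Sum>k<p. \<omega> ^ (k * j)) = (\<Sum>k<p. (\<omega> ^ j) ^ k)"
    by (simp add: mult.commute flip: power_mult)
  also have "\<dots> = ((\<omega> ^ j) ^ p - 1) / (\<omega> ^ j - 1)"
    using False by (intro geometric_sum) (simp add: power_eq_1_iff_dvd)
  also have "(\<omega> ^ j) ^ p = 1"
    by (metis mult.commute power_mult power_one power_order)
  finally show ?thesis using False by simp
qed

lemma ex_power_if_root:
  assumes "z ^ p = 1"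
  obtains x where "x < p" "z = \<omega> ^ x"
proof -
  have "inj_on (\<lambda>x. \<omega> ^ x) {..<p}"
    by (auto simp: inj_on_def power_eq_iff_cong cong_less_modulus_unique_nat)
  then have "card ((\<lambda>x. \<omega> ^ x) ` {..<p}) = p"
    by (simp add: card_image)
  moreover have "(\<lambda>x. \<omega> ^ x) ` {..<p} \<subseteq> {z. z ^ p = 1}"
    by (auto simp: power_eq_1_iff_dvd simp flip: power_mult)
  moreover have "finite {z :: complex. z ^ p = 1}" "card {z :: complex. z ^ p = 1} \<le> p"
    using p_pos by (simp_all add: finite_roots_unity card_roots_unity)
  ultimately have "(\<lambda>x. \<omega> ^ x) ` {..<p} = {z. z ^ p = 1}"
    by (metis card_seteq)
  then show ?thesis using assms that by blast
qed

text \<open>Expanding the power produces sums \<open>(\<Sum>k<p. \<omega> ^ (k * l))\<close>, each equal to \<open>p\<close> or \<open>0\<close>.  The factor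
  \<open>\<omega> ^ (k * j)\<close> is there for the induction, which peels off one factor of the power at a time and
  moves its terms into \<open>j\<close>.\<close>

lemma power_sum_in_Ints:
  assumes "finite X"
  shows "(\<Sum>k<p. (\<Sum>x\<in>X. \<omega> ^ (k * e x)) ^ m * \<omega> ^ (k * j)) \<in> \<int>"
proof (induction m arbitrary: j)
  case 0
  then show ?case by (simp add: sum_powers)
next
  case (Suc m)
  let ?S = "\<lambda>k. \<Sum>x\<in>X. \<omega> ^ (k * e x)"
  have "(\<Sum>k<p. ?S k ^ Suc m * \<omega> ^ (k * j))
      = (\<Sum>k<p. \<Sum>x\<in>X. ?S k ^ m * \<omega> ^ (k * (e x + j)))"
    by (intro sum.cong refl)
      (simp add: sum_distrib_left sum_distrib_right distrib_left power_add mult_ac)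
  also have "\<dots> = (\<Sum>x\<in>X. \<Sum>k<p. ?S k ^ m * \<omega> ^ (k * (e x + j)))"
    by (rule sum.swap)
  also have "\<dots> \<in> \<int>" by (intro Ints_sum Suc.IH)
  finally show ?case .
qed

end

text \<open>The equality case of the triangle inequality: the components of the unit vectors in the direction
  of their sum have the largest possible total, so each of these components is maximal.\<close>

lemma all_equal_if_norm_sum_maximal:
  fixes c :: "'b \<Rightarrow> complex"
  assumes "finite X" and unit: "\<And>x. x \<in> X \<Longrightarrow> norm (c x) = 1"
    and max: "norm (sum c X) = card X" and "x \<in> X" "y \<in> X"
  shows "c x = c y"
proof -
  define s where "s = sum c X"
  have norm_s: "norm s = card X" using max by (simp add: s_def)
  have "card X > 0" using assms by (metis card_gt_0_iff empty_iff)
  have bound: "Re (c z * cnj s) \<le> card X" if "z \<in> X" for z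
    using complex_Re_le_cmod[of "c z * cnj s"] unit[OF that]
    by (simp add: norm_mult norm_s)
  have "(\<Sum>z\<in>X. Re (c z * cnj s)) = Re (s * cnj s)"
    by (simp add: s_def sum_distrib_right)
  also have "\<dots> = (norm s)\<^sup>2"
    by (simp only: complex_norm_square[symmetric] Re_complex_of_real)
  also have "\<dots> = (\<Sum>z\<in>X. real (card X))"
    by (simp add: norm_s power2_eq_square)
  finally have total: "(\<Sum>z\<in>X. real (card X) - Re (c z * cnj s)) = 0"
    by (simp add: sum_subtractf)
  have "c z * cnj s = of_nat (card X)" if "z \<in> X" for z
  proof -
    have "Re (c z * cnj s) = card X"
      using total bound that \<open>finite X\<close> by (subst (asm) sum_nonneg_eq_0_iff) auto
    moreover have "norm (c z * cnj s) = card X"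
      using unit[OF that] by (simp add: norm_mult norm_s)
    ultimately have "Im (c z * cnj s) = 0"
      using cmod_power2[of "c z * cnj s"] by simp
    with \<open>Re (c z * cnj s) = card X\<close> show ?thesis
      by (simp add: complex_eq_iff)
  qed
  then have "c x * cnj s = c y * cnj s" using assms by simp
  moreover have "cnj s \<noteq> 0" using norm_s \<open>card X > 0\<close> by auto
  ultimately show ?thesis by simp
qed

text \<open>An average of \<open>p\<close> roots of unity whose conjugates are all algebraic integers is either zero or
  itself a root of unity; in the latter case its terms agree.  The conjugates are listed by the
  exponents \<open>k\<close>.  The proof works with squared norms because these are real and nonnegative, so that
  no cancellation can occur in their power sums.\<close>

lemma (in primitive_root_of_unity) exponents_cong_if_conjugates_divisible:
  assumes "prime p" and "finite X" "card X = p"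
    and int: "\<And>k. algebraic_int ((\<Sum>x\<in>X. \<omega> ^ (k * e x)) / of_nat p)"
    and nz: "(\<Sum>x\<in>X. \<omega> ^ e x) \<noteq> 0" and xy: "x \<in> X" "y \<in> X"
  shows "[e x = e y] (mod p)"
proof -
  define S where "S k = (\<Sum>x\<in>X. \<omega> ^ (k * e x))" for k
  define z where "z k = (norm (S k / of_nat p))\<^sup>2" for k
  have p: "p > 1" using \<open>prime p\<close> by (rule prime_gt_1_nat)
  have z_eq: "complex_of_real (z k) = (S k / of_nat p) * cnj (S k / of_nat p)" for k
    unfolding z_def by (rule complex_norm_square)
  have "norm (S k) \<le> p" for k
    unfolding S_def using sum_norm_le[of X "\<lambda>x. \<omega> ^ (k * e x)" "\<lambda>_. 1"] \<open>card X = p\<close>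
    by (simp add: norm_power)
  then have z_bounds: "0 \<le> z k" "z k \<le> 1" for k
    using p by (auto simp: z_def norm_divide power_le_one)
  have z1: "z 1 > 0" using nz p by (simp add: z_def S_def)

  \<comment> \<open>These sums are rational, since including \<open>k = 0\<close> turns them into an integer over a power of \<open>p\<close>.\<close>
  have trace_Int: "(\<Sum>k\<in>{1..<p}. z k ^ m) \<in> \<int>" for m
  proof -
    have norm_S: "S k * cnj (S k) = (\<Sum>(x, y)\<in>X \<times> X. \<omega> ^ (k * (e x + (p - 1) * e y)))" for k
    proof -
      have "cnj (S k) = (\<Sum>y\<in>X. \<omega> ^ (k * ((p - 1) * e y)))"
        unfolding S_def cnj_sum cnj_power by (simp add: mult_ac)
      then show ?thesis
        by (simp add: S_def sum_product sum.cartesian_product distrib_left power_add)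
    qed
    have "algebraic_int (S k / of_nat p)" for k
      unfolding S_def by (rule int)
    then have "algebraic_int (complex_of_real (z k))" for k
      unfolding z_eq by (intro algebraic_int_mult algebraic_int_cnj)
    then have "algebraic_int (\<Sum>k\<in>{1..<p}. complex_of_real (z k) ^ m)"
      by (intro algebraic_int_sum algebraic_int_power)
    then have alg: "algebraic_int (complex_of_real (\<Sum>k\<in>{1..<p}. z k ^ m))"
      by simp
    define N where "N = (\<Sum>k<p. (S k * cnj (S k)) ^ m)"
    have "N \<in> \<int>"
      using power_sum_in_Ints[of "X \<times> X" "\<lambda>(x, y). e x + (p - 1) * e y" m 0] \<open>finite X\<close>
      by (simp add: N_def norm_S case_prod_unfold)
    then obtain N' where N': "N = of_int N'" by (auto elim: Ints_cases)
    have "complex_of_real (\<Sum>k<p. z k ^ m) = N / of_nat p ^ (2 * m)"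
      by (simp add: z_eq N_def sum_divide_distrib power_divide power_mult power2_eq_square
          power_mult_distrib)
    also have "\<dots> = of_real (of_int N' / of_nat p ^ (2 * m))"
      by (simp add: N')
    finally have "(\<Sum>k<p. z k ^ m) = of_int N' / of_nat p ^ (2 * m)"
      unfolding of_real_eq_iff .
    then have "(\<Sum>k<p. z k ^ m) \<in> \<rat>" by simp
    moreover have "z 0 = 1"
      using p \<open>card X = p\<close> by (simp add: z_def S_def)
    moreover have "(\<Sum>k<p. z k ^ m) = z 0 ^ m + (\<Sum>k\<in>{1..<p}. z k ^ m)"
      using p by (simp add: lessThan_atLeast0 sum.atLeast_Suc_lessThan)
    ultimately have "(\<Sum>k\<in>{1..<p}. z k ^ m) \<in> \<rat>"
      by (metis Rats_1 Rats_diff add_diff_cancel_left' power_one)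
    with alg show ?thesis
      unfolding algebraic_int_of_real_iff by (rule rational_algebraic_int_is_int)
  qed

  \<comment> \<open>Otherwise the power sums, which are positive integers, would tend to zero.\<close>
  have "\<exists>k\<in>{1..<p}. z k = 1"
  proof (rule ccontr)
    assume "\<not> ?thesis"
    then have "\<bar>z k\<bar> < 1" if "k \<in> {1..<p}" for k
      using that z_bounds[of k] by (metis abs_of_nonneg order_le_less)
    then have "(\<lambda>m. \<Sum>k\<in>{1..<p}. z k ^ m) \<longlonglongrightarrow> (\<Sum>k\<in>{1..<p}. 0)"
      by (intro tendsto_sum LIMSEQ_power_zero) auto
    from order_tendstoD(2)[OF this, of 1]
    obtain m where lt: "(\<Sum>k\<in>{1..<p}. z k ^ m) < 1"
      by (auto simp: eventually_sequentially)
    have "z 1 ^ m \<le> (\<Sum>k\<in>{1..<p}. z k ^ m)"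
      using p z_bounds by (intro member_le_sum) auto
    then have "(\<Sum>k\<in>{1..<p}. z k ^ m) > 0"
      using zero_less_power[OF z1, of m] by linarith
    with trace_Int[of m] lt show False
      by (auto elim!: Ints_cases)
  qed
  then obtain k where k: "1 \<le> k" "k < p" "z k = 1" by auto
  have "norm (S k / of_nat p) = 1"
    using k(3) power2_eq_imp_eq[of "norm (S k / of_nat p)" 1] unfolding z_def by simp
  then have "norm (S k) = card X"
    using p \<open>card X = p\<close> by (simp add: norm_divide)
  then have "\<omega> ^ (k * e x) = \<omega> ^ (k * e y)"
    unfolding S_def using xy \<open>finite X\<close>
    by (intro all_equal_if_norm_sum_maximal[of X "\<lambda>x. \<omega> ^ (k * e x)"]) (simp_all add: norm_power)
  then have "[k * e x = k * e y] (mod p)" by (simp add: power_eq_iff_cong)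
  moreover have "coprime k p"
    using k prime_imp_coprime[OF \<open>prime p\<close>, of k] nat_dvd_not_less[of k p]
    by (simp add: coprime_commute)
  ultimately show ?thesis by (simp add: cong_mult_lcancel_nat)
qed

lemma primitive_root_of_unity_exp:
  assumes "n > 0"
  shows "primitive_root_of_unity n (exp (2 * of_real pi * \<i> / of_nat n))"
proof
  let ?w = "exp (2 * of_real pi * \<i> / of_nat n)"
  have w: "?w ^ k = cis (2 * pi * real k / real n)" for k
    by (simp add: cis_conv_exp mult_ac flip: exp_of_nat_mult)
  show "?w ^ k = 1 \<longleftrightarrow> n dvd k" for k
  proof -
    have "?w ^ n = 1" using assms by (simp add: w)
    then have "?w ^ k = ?w ^ (k mod n)"
      by (metis mod_mult_div_eq mult.right_neutral power_add power_mult power_one)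
    also have "\<dots> = 1 \<longleftrightarrow> k mod n = 0"
      using bij_betw_roots_unity[OF assms] assms
        inj_onD[of "\<lambda>k. cis (2 * pi * real k / real n)" "{..<n}" "k mod n" 0]
      unfolding w by (auto simp: bij_betw_def)
    finally show ?thesis by (simp add: dvd_eq_mod_eq_0)
  qed
qed fact

section \<open>Irreducible characters of cyclic groups\<close>

definition linear_characters :: "('a, 'b) monoid_scheme \<Rightarrow> ('a \<Rightarrow> complex) set" where
  "linear_characters G =
     {\<chi>. \<chi> \<one>\<^bsub>G\<^esub> = 1 \<and> (\<forall>g\<in>carrier G. \<forall>h\<in>carrier G. \<chi> (g \<otimes>\<^bsub>G\<^esub> h) = \<chi> g * \<chi> h) \<and>
         (\<forall>g. g \<notin> carrier G \<longrightarrow> \<chi> g = 0)}"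

lemma linear_character_pow:
  assumes "monoid G" "\<chi> \<in> linear_characters G" "u \<in> carrier G"
  shows "\<chi> (u [^]\<^bsub>G\<^esub> (k::nat)) = \<chi> u ^ k"
proof -
  interpret monoid G by fact
  show ?thesis
    using assms(2,3) by (induction k) (auto simp: linear_characters_def)
qed

lemma GL_mat_simps:
  "A \<otimes>\<^bsub>GL_mat n\<^esub> B = A * B" "\<one>\<^bsub>GL_mat n\<^esub> = 1\<^sub>m n"
  "A \<in> carrier (GL_mat n) \<longleftrightarrow>
     A \<in> carrier_mat n n \<and> (\<exists>B\<in>carrier_mat n n. B * A = 1\<^sub>m n \<and> A * B = 1\<^sub>m n)"
  by (auto simp: GL_mat_def units_of_def ring_mat_simps Units_def)

lemma group_GL_mat: "group (GL_mat n)"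
proof -
  interpret ring "ring_mat TYPE(complex) n ()" by (rule ring_mat)
  show ?thesis unfolding GL_mat_def by (rule units_group)
qed

lemma
  assumes "group G" and \<rho>: "\<rho> \<in> hom G (GL_mat n)"
  shows hom_GL_mat_carrier: "g \<in> carrier G \<Longrightarrow> \<rho> g \<in> carrier_mat n n"
    and hom_GL_mat_mult: "g \<in> carrier G \<Longrightarrow> h \<in> carrier G \<Longrightarrow> \<rho> (g \<otimes>\<^bsub>G\<^esub> h) = \<rho> g * \<rho> h"
    and hom_GL_mat_one: "\<rho> \<one>\<^bsub>G\<^esub> = 1\<^sub>m n"
  using hom_in_carrier[OF \<rho>] hom_mult[OF \<rho>] hom_one[OF \<rho> \<open>group G\<close> group_GL_mat]
  by (auto simp: GL_mat_simps)

text \<open>A multiplicative function is the trace of the representation by \<open>1 \<times> 1\<close> matrices, and a line has no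
  proper nonzero subspace.\<close>

lemma linear_character_in_Irr:
  assumes "group G" and \<chi>: "\<chi> \<in> linear_characters G"
  shows "\<chi> \<in> Irr G"
proof -
  interpret group G by fact
  define \<rho> where "\<rho> g = mat 1 1 (\<lambda>_. \<chi> g)" for g
  have mult: "\<chi> (g \<otimes>\<^bsub>G\<^esub> h) = \<chi> g * \<chi> h" if "g \<in> carrier G" "h \<in> carrier G" for g h
    using \<chi> that by (simp add: linear_characters_def)
  have one: "\<chi> \<one>\<^bsub>G\<^esub> = 1" using \<chi> by (simp add: linear_characters_def)
  have \<rho>_mult: "\<rho> (g \<otimes>\<^bsub>G\<^esub> h) = \<rho> g * \<rho> h" if "g \<in> carrier G" "h \<in> carrier G" for g h
    using mult[OF that] by (intro eq_matI) (auto simp: \<rho>_def scalar_prod_def)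
  have \<rho>_one: "\<rho> \<one>\<^bsub>G\<^esub> = 1\<^sub>m 1"
    by (intro eq_matI) (auto simp: \<rho>_def one)
  have hom: "\<rho> \<in> hom G (GL_mat 1)"
  proof (rule homI)
    fix g assume g: "g \<in> carrier G"
    show "\<rho> g \<in> carrier (GL_mat 1)"
      unfolding GL_mat_simps
      using g \<rho>_mult[of g "inv\<^bsub>G\<^esub> g"] \<rho>_mult[of "inv\<^bsub>G\<^esub> g" g] \<rho>_one
      by (intro conjI bexI[of _ "\<rho> (inv\<^bsub>G\<^esub> g)"]) (auto simp: \<rho>_def)
  qed (simp add: \<rho>_mult GL_mat_simps)
  have "W = {0\<^sub>v 1} \<or> W = carrier_vec 1"
    if W: "VectorSpace.subspace class_ring W (module_vec TYPE(complex) 1)" for W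
  proof (cases "W \<subseteq> {0\<^sub>v 1}")
    case True
    moreover have "0\<^sub>v 1 \<in> W"
      using W by (auto simp: VectorSpace.subspace_def submodule_def module_vec_def)
    ultimately show ?thesis by blast
  next
    case False
    then obtain w where w: "w \<in> W" "w \<noteq> 0\<^sub>v 1" by blast
    have sub: "W \<subseteq> carrier_vec 1" and smult: "\<And>c v. v \<in> W \<Longrightarrow> c \<cdot>\<^sub>v v \<in> W"
      using W by (auto simp: VectorSpace.subspace_def submodule_def module_vec_def)
    have "w $ 0 \<noteq> 0"
    proof
      assume "w $ 0 = 0"
      then have "w = 0\<^sub>v 1" using w sub by (intro eq_vecI) auto
      with w show False by simp
    qed
    have "v \<in> W" if v: "v \<in> carrier_vec 1" for v
    proof -
      have "v = (v $ 0 / w $ 0) \<cdot>\<^sub>v w"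
        using v w sub \<open>w $ 0 \<noteq> 0\<close> by (intro eq_vecI) auto
      then show ?thesis using smult[OF w(1)] by metis
    qed
    with sub show ?thesis by blast
  qed
  with hom have "irreducible_rep G 1 \<rho>"
    by (auto simp: irreducible_rep_def)
  moreover have "\<chi> = rep_character G 1 \<rho>"
    using \<chi> by (auto simp: rep_character_def \<rho>_def linear_characters_def)
  ultimately show ?thesis unfolding Irr_def by blast
qed

text \<open>Over the complex numbers, the matrix of the generator has an eigenvector.  The line through it is invariant
  under the whole group, hence is the whole space by irreducibility.\<close>

lemma irreducible_rep_cyclic_degree:
  assumes "group G" and u: "u \<in> carrier G" and gen: "carrier G = range (\<lambda>k::nat. u [^]\<^bsub>G\<^esub> k)"
    and irr: "irreducible_rep G n \<rho>"
  shows "n = 1"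
proof -
  interpret group G by fact
  have n: "n > 0" and hom: "\<rho> \<in> hom G (GL_mat n)"
    and min: "\<And>W. VectorSpace.subspace class_ring W (module_vec TYPE(complex) n) \<Longrightarrow>
      (\<And>g w. g \<in> carrier G \<Longrightarrow> w \<in> W \<Longrightarrow> \<rho> g *\<^sub>v w \<in> W) \<Longrightarrow> W = {0\<^sub>v n} \<or> W = carrier_vec n"
    using irr unfolding irreducible_rep_def by auto
  note \<rho> = hom_GL_mat_carrier[OF \<open>group G\<close> hom]
    and \<rho>_mult = hom_GL_mat_mult[OF \<open>group G\<close> hom]
    and \<rho>_one = hom_GL_mat_one[OF \<open>group G\<close> hom]
  obtain l v where v: "v \<in> carrier_vec n" "v \<noteq> 0\<^sub>v n" "\<rho> u *\<^sub>v v = l \<cdot>\<^sub>v v"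
    using spectrum_non_empty[OF \<rho>[OF u] n] \<rho>[OF u]
    unfolding spectrum_def eigenvalue_def eigenvector_def by auto
  define W where "W = range (\<lambda>c. c \<cdot>\<^sub>v v)"
  have W_smult: "c \<cdot>\<^sub>v w \<in> W" if "w \<in> W" for c w
    using that by (auto simp: W_def smult_smult_assoc)
  have sub: "VectorSpace.subspace class_ring W (module_vec TYPE(complex) n)"
    unfolding VectorSpace.subspace_def
  proof
    show "vectorspace class_ring (module_vec TYPE(complex) n)" by (rule vec_vs)
    then show "submodule class_ring W (module_vec TYPE(complex) n)"
    proof (intro submodule.intro)
      show "W \<subseteq> carrier (module_vec TYPE(complex) n)"
        using v(1) by (auto simp: W_def module_vec_def)
      show "\<zero>\<^bsub>module_vec TYPE(complex) n\<^esub> \<in> W"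
        using v(1) by (auto simp: W_def module_vec_def intro!: image_eqI[of _ _ 0])
      show "a \<oplus>\<^bsub>module_vec TYPE(complex) n\<^esub> b \<in> W" if "a \<in> W" "b \<in> W" for a b
        using that by (auto simp: W_def module_vec_def simp flip: add_smult_distrib_vec)
    qed (auto simp: vectorspace_def module_vec_def W_smult)
  qed
  have "\<rho> (u [^]\<^bsub>G\<^esub> (k::nat)) *\<^sub>v w \<in> W" if "w \<in> W" for k w
    using that
  proof (induction k arbitrary: w)
    case 0
    then have "w \<in> carrier_vec n" using v(1) by (auto simp: W_def)
    then show ?case using 0 by (simp add: \<rho>_one)
  next
    case (Suc k)
    then obtain c where c: "w = c \<cdot>\<^sub>v v" by (auto simp: W_def)
    have "\<rho> (u [^]\<^bsub>G\<^esub> Suc k) *\<^sub>v w = \<rho> (u [^]\<^bsub>G\<^esub> k) *\<^sub>v (\<rho> u *\<^sub>v w)"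
      using u v(1) \<rho>[of u] \<rho>[of "u [^]\<^bsub>G\<^esub> k"]
      by (simp add: \<rho>_mult c assoc_mult_mat_vec)
    also have "\<rho> u *\<^sub>v w = (c * l) \<cdot>\<^sub>v v"
      using v \<rho>[OF u] by (simp add: c mult_mat_vec smult_smult_assoc)
    finally show ?case using Suc.IH[of "(c * l) \<cdot>\<^sub>v v"] by (simp add: W_def)
  qed
  then have "W = {0\<^sub>v n} \<or> W = carrier_vec n"
    using min[OF sub] gen by auto
  moreover have "1 \<cdot>\<^sub>v v \<in> W" unfolding W_def by blast
  ultimately have W: "W = carrier_vec n" using v(2) by auto
  \<comment> \<open>Two different unit vectors are not both multiples of \<open>v\<close>.\<close>
  show "n = 1"
  proof (rule ccontr)
    assume "n \<noteq> 1"
    with n have n2: "n > 1" by simp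
    obtain c d where c: "unit_vec n 0 = c \<cdot>\<^sub>v v" and d: "unit_vec n 1 = d \<cdot>\<^sub>v v"
      using W unfolding W_def by (metis imageE unit_vec_carrier)
    have "c * v $ 0 = 1" "d * v $ 0 = 0" "d * v $ 1 = 1"
      using n2 v(1) arg_cong[OF c, of "\<lambda>v. v $ 0"] arg_cong[OF d, of "\<lambda>v. v $ 0"]
        arg_cong[OF d, of "\<lambda>v. v $ 1"] by simp_all
    then show False by auto
  qed
qed

lemma Irr_cyclic:
  assumes "group G" and u: "u \<in> carrier G" and gen: "carrier G = range (\<lambda>k::nat. u [^]\<^bsub>G\<^esub> k)"
  shows "Irr G = linear_characters G"
proof
  show "linear_characters G \<subseteq> Irr G"
    using linear_character_in_Irr[OF \<open>group G\<close>] by blast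
  show "Irr G \<subseteq> linear_characters G"
  proof
    fix \<chi> assume "\<chi> \<in> Irr G"
    then obtain n \<rho> where \<chi>: "\<chi> = rep_character G n \<rho>" and irr: "irreducible_rep G n \<rho>"
      unfolding Irr_def by blast
    have n: "n = 1" by (rule irreducible_rep_cyclic_degree[OF assms irr])
    have hom: "\<rho> \<in> hom G (GL_mat 1)" using irr n by (simp add: irreducible_rep_def)
    interpret group G by fact
    note \<rho> = hom_GL_mat_carrier[OF \<open>group G\<close> hom]
      and \<rho>_mult = hom_GL_mat_mult[OF \<open>group G\<close> hom]
      and \<rho>_one = hom_GL_mat_one[OF \<open>group G\<close> hom]
    have "(\<rho> g * \<rho> h) $$ (0, 0) = \<rho> g $$ (0, 0) * \<rho> h $$ (0, 0)"
      if "g \<in> carrier G" "h \<in> carrier G" for g h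
      using \<rho>[OF that(1)] \<rho>[OF that(2)] by (simp add: scalar_prod_def)
    then show "\<chi> \<in> linear_characters G"
      by (simp add: \<chi> n linear_characters_def rep_character_def \<rho>_mult \<rho>_one)
  qed
qed

locale generated_cyclic_group = group G for G (structure) +
  fixes p :: nat and u
  assumes p_pos: "p > 0" and order_eq: "Coset.order G = p"
    and u_closed: "u \<in> carrier G" and generated: "carrier G = generate G {u}"
begin

lemma finite_carrier: "finite (carrier G)"
  using order_eq p_pos by (metis order_gt_0_iff_finite)

lemma carrier_eq: "carrier G = range (\<lambda>k::nat. u [^] k)"
  using generate_pow_on_finite_carrier[OF finite_carrier u_closed] generated by auto

lemma pow_mod: "u [^] (k mod p) = u [^] k"
proof -
  have "u [^] p = \<one>" using pow_order_eq_1[OF u_closed] order_eq by simp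
  then have "u [^] (p * (k div p)) = \<one>"
    by (simp flip: nat_pow_pow[OF u_closed])
  then have "u [^] (k mod p + p * (k div p)) = u [^] (k mod p)"
    using u_closed nat_pow_mult[OF u_closed, of "k mod p" "p * (k div p)"] by simp
  then show ?thesis by simp
qed

lemma bij_betw_pow: "bij_betw (\<lambda>k. u [^] k) {..<p} (carrier G)"
proof -
  have "u [^] k \<in> (\<lambda>k. u [^] k) ` {..<p}" for k :: nat
    using pow_mod[of k] p_pos by (intro image_eqI[of _ _ "k mod p"]) auto
  then have im: "(\<lambda>k. u [^] k) ` {..<p} = carrier G"
    unfolding carrier_eq by auto
  then have "inj_on (\<lambda>k. u [^] k) {..<p}"
    using order_eq by (intro eq_card_imp_inj_on) (simp_all add: Coset.order_def)
  with im show ?thesis by (simp add: bij_betw_def)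
qed

lemma pow_eq_one_iff: "u [^] k = \<one> \<longleftrightarrow> p dvd k"
proof -
  have "u [^] k = \<one> \<longleftrightarrow> u [^] (k mod p) = u [^] (0::nat)"
    by (simp add: pow_mod)
  also have "\<dots> \<longleftrightarrow> k mod p = 0"
    using bij_betw_pow p_pos by (auto simp: bij_betw_def inj_on_def)
  finally show ?thesis by (simp add: dvd_eq_mod_eq_0)
qed

end

text \<open>Only the multiplicative order of \<open>\<omega>\<close> matters; another choice of primitive root
  permutes the family \<open>chi\<close>.\<close>

locale cyclic_character_table = generated_cyclic_group G p u + primitive_root_of_unity p \<omega>
  for G :: "('a, 'b) monoid_scheme" (structure) and p u \<omega> +
  fixes chi :: "nat \<Rightarrow> 'a \<Rightarrow> complex"
  assumes chi_outside: "x < p \<Longrightarrow> g \<notin> carrier G \<Longrightarrow> chi x g = 0"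
    and chi_pow: "x < p \<Longrightarrow> chi x (u [^] (a::nat)) = \<omega> ^ (a * x)"
begin

lemma linear_characters_eq: "linear_characters G = chi ` {..<p}"
proof
  show "chi ` {..<p} \<subseteq> linear_characters G"
  proof (clarsimp simp: linear_characters_def chi_outside, intro conjI ballI)
    fix x assume x: "x < p"
    show "chi x \<one> = 1" using chi_pow[OF x, of 0] by simp
    fix g h assume "g \<in> carrier G" "h \<in> carrier G"
    then obtain a b :: nat where "g = u [^] a" "h = u [^] b" unfolding carrier_eq by blast
    then show "chi x (g \<otimes> h) = chi x g * chi x h"
      using u_closed chi_pow[OF x, of "a + b"]
      by (simp add: chi_pow x distrib_right power_add flip: nat_pow_mult)
  qed
  show "linear_characters G \<subseteq> chi ` {..<p}"
  proof
    fix \<chi> assume \<chi>: "\<chi> \<in> linear_characters G"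
    have \<chi>_pow: "\<chi> (u [^] k) = \<chi> u ^ k" for k :: nat
      by (rule linear_character_pow[OF is_monoid \<chi> u_closed])
    \<comment> \<open>A linear character is determined by its value at \<open>u\<close>, which is a \<open>p\<close>-th root of unity.\<close>
    have "\<chi> u ^ p = 1"
      using \<chi>_pow[of p] \<chi> pow_eq_one_iff[of p] by (simp add: linear_characters_def)
    then obtain x where x: "x < p" "\<chi> u = \<omega> ^ x" by (rule ex_power_if_root)
    have "\<chi> g = chi x g" for g
    proof (cases "g \<in> carrier G")
      case True
      then obtain a :: nat where "g = u [^] a" unfolding carrier_eq by blast
      then show ?thesis using x chi_pow[of x a] \<chi>_pow[of a]
        by (simp add: mult.commute flip: power_mult)
    next
      case False
      then show ?thesis using \<chi> chi_outside x by (simp add: linear_characters_def)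
    qed
    then show "\<chi> \<in> chi ` {..<p}" using x by blast
  qed
qed

lemma Irr_eq: "Irr G = chi ` {..<p}"
  using Irr_cyclic[OF is_group u_closed carrier_eq] linear_characters_eq by simp

lemma inj_on_chi: "inj_on chi {..<p}"
proof (rule inj_onI)
  fix x y assume xy: "x \<in> {..<p}" "y \<in> {..<p}" "chi x = chi y"
  then have "\<omega> ^ x = \<omega> ^ y"
    using chi_pow[of x 1] chi_pow[of y 1] by simp
  then show "x = y"
    using xy by (simp add: power_eq_iff_cong cong_less_modulus_unique_nat)
qed

lemma char_inner_chi:
  assumes "x < p" "y < p"
  shows "char_inner G (chi x) (chi y) = (if x = y then 1 else 0)"
proof -
  have "(\<Sum>g\<in>carrier G. chi x g * cnj (chi y g)) = (\<Sum>k<p. chi x (u [^] k) * cnj (chi y (u [^] k)))"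
    by (rule sum.reindex_bij_betw[OF bij_betw_pow, symmetric])
  also have "\<dots> = (\<Sum>k<p. \<omega> ^ (k * (x + (p - 1) * y)))"
    using assms by (simp only: chi_pow cnj_power power_add distrib_left mult.left_commute)
  also have "\<dots> = (if p dvd x + (p - 1) * y then of_nat p else 0)"
    by (rule sum_powers)
  also have "p dvd x + (p - 1) * y \<longleftrightarrow> x = y"
  proof -
    have unit: "\<omega> ^ y * cnj (\<omega> ^ y) = 1"
      by (simp only: complex_norm_square[symmetric] norm_power norm_1 power_one of_real_1)
    have "p dvd x + (p - 1) * y \<longleftrightarrow> \<omega> ^ x * cnj (\<omega> ^ y) = 1"
      by (simp only: cnj_power power_eq_1_iff_dvd flip: power_add)
    also have "\<dots> \<longleftrightarrow> \<omega> ^ x = \<omega> ^ y"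
      using unit by (metis mult_right_cancel mult_zero_right zero_neq_one)
    also have "\<dots> \<longleftrightarrow> x = y"
      using assms by (auto simp: power_eq_iff_cong cong_less_modulus_unique_nat)
    finally show ?thesis .
  qed
  finally show ?thesis
    using p_pos by (simp add: char_inner_def order_eq)
qed

lemma mu_eq:
  assumes f: "\<And>x. x < p \<Longrightarrow> f x < p" and I: "\<And>x. x < p \<Longrightarrow> I (chi x) = chi (f x)"
  shows "mu G I (u [^] (a::nat)) (u [^] (b::nat)) = (\<Sum>x<p. \<omega> ^ (a * f x + b * x))"
  unfolding mu_def Irr_eq sum.reindex[OF inj_on_chi] o_def
  by (intro sum.cong refl) (simp add: I f chi_pow power_add)

end

section \<open>Isometries of the character ring\<close>

text \<open>Coordinates with respect to an orthonormal family determine inner products; used once for \<^term>\<open>Irr G\<close>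
  and once for its image under a linear map, which then preserves inner products if both families are
  orthonormal.\<close>

lemma char_inner_int_combination:
  assumes ortho: "\<And>x y. x \<in> X \<Longrightarrow> y \<in> X \<Longrightarrow> char_inner G (\<psi> x) (\<psi> y) = (if x = y then 1 else 0)"
    and "finite X"
  shows "char_inner G (\<lambda>g. \<Sum>x\<in>X. of_int (c x) * \<psi> x g) (\<lambda>g. \<Sum>x\<in>X. of_int (d x) * \<psi> x g)
       = (\<Sum>x\<in>X. of_int (c x * d x))"
proof -
  have "char_inner G (\<lambda>g. \<Sum>x\<in>X. of_int (c x) * \<psi> x g) (\<lambda>g. \<Sum>x\<in>X. of_int (d x) * \<psi> x g)
      = (\<Sum>g\<in>carrier G. \<Sum>x\<in>X. \<Sum>y\<in>X. of_int (c x * d y) * (\<psi> x g * cnj (\<psi> y g)))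
          / of_nat (Coset.order G)"
    by (simp add: char_inner_def sum_product mult_ac)
  also have "(\<Sum>g\<in>carrier G. \<Sum>x\<in>X. \<Sum>y\<in>X. of_int (c x * d y) * (\<psi> x g * cnj (\<psi> y g)))
      = (\<Sum>x\<in>X. \<Sum>y\<in>X. \<Sum>g\<in>carrier G. of_int (c x * d y) * (\<psi> x g * cnj (\<psi> y g)))"
    by (subst sum.swap) (intro sum.cong refl sum.swap)
  also have "\<dots> / of_nat (Coset.order G)
      = (\<Sum>x\<in>X. \<Sum>y\<in>X. of_int (c x * d y) * char_inner G (\<psi> x) (\<psi> y))"
    by (simp add: char_inner_def sum_divide_distrib sum_distrib_left)
  also have "\<dots> = (\<Sum>x\<in>X. \<Sum>y\<in>X. if x = y then of_int (c x * d y) else 0)"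
    by (intro sum.cong refl) (simp add: ortho)
  also have "\<dots> = (\<Sum>x\<in>X. of_int (c x * d x))"
    using \<open>finite X\<close> by simp
  finally show ?thesis .
qed

lemma character_ringI:
  "\<phi> = (\<lambda>g. \<Sum>\<chi>\<in>Irr G. of_int (c \<chi>) * \<chi> g) \<Longrightarrow> \<phi> \<in> character_ring G"
  by (auto simp: character_ring_def)

lemma character_ring_add:
  assumes "\<phi> \<in> character_ring G" "\<psi> \<in> character_ring G"
  shows "(\<lambda>g. \<phi> g + \<psi> g) \<in> character_ring G"
proof -
  obtain c d where "\<phi> = (\<lambda>g. \<Sum>\<chi>\<in>Irr G. of_int (c \<chi>) * \<chi> g)"
    "\<psi> = (\<lambda>g. \<Sum>\<chi>\<in>Irr G. of_int (d \<chi>) * \<chi> g)"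
    using assms unfolding character_ring_def by blast
  then have "(\<lambda>g. \<phi> g + \<psi> g) = (\<lambda>g. \<Sum>\<chi>\<in>Irr G. of_int (c \<chi> + d \<chi>) * \<chi> g)"
    by (simp add: sum.distrib distrib_right)
  then show ?thesis by (rule character_ringI)
qed

lemma character_ring_scale:
  assumes "\<phi> \<in> character_ring G"
  shows "(\<lambda>g. of_int n * \<phi> g) \<in> character_ring G"
proof -
  obtain c where "\<phi> = (\<lambda>g. \<Sum>\<chi>\<in>Irr G. of_int (c \<chi>) * \<chi> g)"
    using assms unfolding character_ring_def by blast
  then have "(\<lambda>g. of_int n * \<phi> g) = (\<lambda>g. \<Sum>\<chi>\<in>Irr G. of_int (n * c \<chi>) * \<chi> g)"
    by (simp add: sum_distrib_left mult.assoc)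
  then show ?thesis by (rule character_ringI)
qed

lemma character_ring_zero: "(\<lambda>g. 0) \<in> character_ring G"
  by (rule character_ringI[where c = "\<lambda>_. 0"]) simp

lemma Irr_in_character_ring:
  assumes "finite (Irr G)" "\<chi> \<in> Irr G"
  shows "\<chi> \<in> character_ring G"
proof -
  have "(\<Sum>\<psi>\<in>Irr G. of_int (if \<psi> = \<chi> then 1 else 0) * \<psi> g) = \<chi> g" for g
  proof -
    have "(\<Sum>\<psi>\<in>Irr G. of_int (if \<psi> = \<chi> then 1 else 0) * \<psi> g)
        = (\<Sum>\<psi>\<in>Irr G. if \<psi> = \<chi> then \<psi> g else 0)"
      by (rule sum.cong) auto
    then show ?thesis using assms by simp
  qed
  then show ?thesis
    by (intro character_ringI[where c = "\<lambda>\<psi>. if \<psi> = \<chi> then 1 else 0"]) simp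
qed

context
  fixes G :: "('a, 'b) monoid_scheme" and I
  assumes lin: "linear_on_characters G I"
begin

lemma linear_on_characters_add:
  "\<phi> \<in> character_ring G \<Longrightarrow> \<psi> \<in> character_ring G \<Longrightarrow> I (\<lambda>g. \<phi> g + \<psi> g) = (\<lambda>g. I \<phi> g + I \<psi> g)"
  using lin by (simp add: linear_on_characters_def)

lemma linear_on_characters_zero: "I (\<lambda>g. 0) = (\<lambda>g. 0)"
proof
  fix g
  have "I (\<lambda>g. 0) g = I (\<lambda>g. 0) g + I (\<lambda>g. 0) g"
    using fun_cong[OF linear_on_characters_add[OF character_ring_zero character_ring_zero], of g]
    by simp
  then show "I (\<lambda>g. 0) g = 0" by simp
qed

lemma linear_on_characters_scale:
  assumes \<phi>: "\<phi> \<in> character_ring G"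
  shows "I (\<lambda>g. of_int n * \<phi> g) = (\<lambda>g. of_int n * I \<phi> g)"
proof -
  have nat: "I (\<lambda>g. of_nat m * \<phi> g) = (\<lambda>g. of_nat m * I \<phi> g)" for m
  proof (induction m)
    case 0
    then show ?case by (simp add: linear_on_characters_zero)
  next
    case (Suc m)
    have "(\<lambda>g. of_nat m * \<phi> g) \<in> character_ring G"
      using character_ring_scale[OF \<phi>, of "int m"] by simp
    from linear_on_characters_add[OF \<phi> this] show ?case
      by (simp add: Suc.IH distrib_right)
  qed
  show ?thesis
  proof (cases n rule: int_cases2)
    case (nonneg m)
    then show ?thesis by (simp add: nat)
  next
    case (nonpos m)
    have "(\<lambda>g. of_int n * \<phi> g) \<in> character_ring G" "(\<lambda>g. of_nat m * \<phi> g) \<in> character_ring G"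
      using character_ring_scale[OF \<phi>, of n] character_ring_scale[OF \<phi>, of "int m"] by simp_all
    from linear_on_characters_add[OF this]
    have "(\<lambda>g. I (\<lambda>g. of_int n * \<phi> g) g + of_nat m * I \<phi> g) = (\<lambda>g. 0)"
      by (simp add: nonpos nat linear_on_characters_zero)
    then show ?thesis
      by (simp add: nonpos fun_eq_iff eq_neg_iff_add_eq_0)
  qed
qed

lemma linear_on_characters_int_combination:
  assumes "finite X" "\<And>x. x \<in> X \<Longrightarrow> \<psi> x \<in> character_ring G"
  shows "(\<lambda>g. \<Sum>x\<in>X. of_int (c x) * \<psi> x g) \<in> character_ring G \<and>
    I (\<lambda>g. \<Sum>x\<in>X. of_int (c x) * \<psi> x g) = (\<lambda>g. \<Sum>x\<in>X. of_int (c x) * I (\<psi> x) g)"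
  using assms
proof (induction X)
  case empty
  then show ?case by (simp add: linear_on_characters_zero character_ring_zero)
next
  case (insert x X)
  then have "(\<lambda>g. of_int (c x) * \<psi> x g) \<in> character_ring G"
    by (intro character_ring_scale) auto
  with insert show ?case
    by (simp add: character_ring_add linear_on_characters_add linear_on_characters_scale)
qed

lemma character_isometry_if_orthonormal_images:
  assumes fin: "finite (Irr G)"
    and ortho: "\<And>\<chi> \<psi>. \<chi> \<in> Irr G \<Longrightarrow> \<psi> \<in> Irr G \<Longrightarrow> char_inner G \<chi> \<psi> = (if \<chi> = \<psi> then 1 else 0)"
    and ortho_I: "\<And>\<chi> \<psi>. \<chi> \<in> Irr G \<Longrightarrow> \<psi> \<in> Irr G \<Longrightarrow>
      char_inner G (I \<chi>) (I \<psi>) = (if \<chi> = \<psi> then 1 else 0)"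
  shows "character_isometry G I"
  unfolding character_isometry_def
proof (intro conjI ballI lin)
  fix \<phi> \<psi> assume "\<phi> \<in> character_ring G" "\<psi> \<in> character_ring G"
  then obtain c d where \<phi>: "\<phi> = (\<lambda>g. \<Sum>\<chi>\<in>Irr G. of_int (c \<chi>) * \<chi> g)"
    and \<psi>: "\<psi> = (\<lambda>g. \<Sum>\<chi>\<in>Irr G. of_int (d \<chi>) * \<chi> g)"
    unfolding character_ring_def by blast
  have I_comb: "I (\<lambda>g. \<Sum>\<chi>\<in>Irr G. of_int (c \<chi>) * \<chi> g) = (\<lambda>g. \<Sum>\<chi>\<in>Irr G. of_int (c \<chi>) * I \<chi> g)" for c
    using linear_on_characters_int_combination[OF fin, of "\<lambda>\<chi>. \<chi>"] Irr_in_character_ring[OF fin]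
    by simp
  show "char_inner G (I \<phi>) (I \<psi>) = char_inner G \<phi> \<psi>"
    unfolding \<phi> \<psi> I_comb
    using char_inner_int_combination[of "Irr G" G "\<lambda>\<chi>. \<chi>" c d]
      char_inner_int_combination[of "Irr G" G I c d] ortho ortho_I fin by simp
qed

end

lemma (in cyclic_character_table) character_isometry_if_permutes:
  assumes "linear_on_characters G I" and f: "bij_betw f {..<p} {..<p}"
    and I: "\<And>x. x < p \<Longrightarrow> I (chi x) = chi (f x)"
  shows "character_isometry G I"
proof (rule character_isometry_if_orthonormal_images[OF assms(1)])
  show "finite (Irr G)" by (simp add: Irr_eq)
  have f_less: "f x < p" if "x < p" for x
    using f that by (auto simp: bij_betw_def)
  fix \<chi> \<psi> assume "\<chi> \<in> Irr G" "\<psi> \<in> Irr G"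
  then obtain x y where xy: "x < p" "y < p" and \<chi>: "\<chi> = chi x" "\<psi> = chi y"
    by (auto simp: Irr_eq)
  have "\<chi> = \<psi> \<longleftrightarrow> x = y"
    using xy inj_on_chi by (auto simp: \<chi> inj_on_def)
  moreover have "f x = f y \<longleftrightarrow> x = y"
    using xy f by (auto simp: bij_betw_def inj_on_def)
  ultimately show "char_inner G \<chi> \<psi> = (if \<chi> = \<psi> then 1 else 0)"
    "char_inner G (I \<chi>) (I \<psi>) = (if \<chi> = \<psi> then 1 else 0)"
    using xy by (simp_all add: \<chi> I char_inner_chi f_less)
qed

section \<open>Exponential sums of affine maps\<close>

context primitive_root_of_unity
begin

lemma sum_powers_affine:
  assumes "\<And>x. x < p \<Longrightarrow> [f x = \<alpha> * x + \<beta>] (mod p)"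
  shows "(\<Sum>x<p. \<omega> ^ (a * f x + b * x)) = (if p dvd a * \<alpha> + b then of_nat p * \<omega> ^ (a * \<beta>) else 0)"
proof -
  have "\<omega> ^ (a * f x + b * x) = \<omega> ^ (a * \<beta>) * \<omega> ^ (x * (a * \<alpha> + b))" if "x < p" for x
  proof -
    have "[a * f x + b * x = a * (\<alpha> * x + \<beta>) + b * x] (mod p)"
      using assms[OF that] by (intro cong_add cong_mult cong_refl)
    also have "a * (\<alpha> * x + \<beta>) + b * x = a * \<beta> + x * (a * \<alpha> + b)"
      by (simp add: algebra_simps)
    finally show ?thesis by (simp flip: power_add add: power_eq_iff_cong)
  qed
  then have "(\<Sum>x<p. \<omega> ^ (a * f x + b * x)) = \<omega> ^ (a * \<beta>) * (\<Sum>x<p. \<omega> ^ (x * (a * \<alpha> + b)))"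
    by (simp add: sum_distrib_left)
  then show ?thesis by (simp add: sum_powers)
qed

text \<open>By orthogonality only the term \<open>x = 0\<close> survives when the sums \<open>(\<Sum>x<p. \<omega> ^ (f x + b * x))\<close> are added
  up over \<open>b\<close>, so they do not all vanish.  For a \<open>b\<close> with nonvanishing sum, the conjugates of the sum
  are the ones with parameters \<open>(k, k * b)\<close>, and all of its terms agree.\<close>

lemma affine_if_sums_divisible:
  assumes "prime p"
    and int: "\<And>a b. algebraic_int ((\<Sum>x<p. \<omega> ^ (a * f x + b * x)) / of_nat p)"
  obtains b where "b < p" "\<And>x. x < p \<Longrightarrow> [f x + b * x = f 0] (mod p)"
proof -
  have "(\<Sum>b<p. \<Sum>x<p. \<omega> ^ (f x + b * x)) = (\<Sum>x<p. \<omega> ^ f x * (\<Sum>b<p. \<omega> ^ (b * x)))"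
    by (subst sum.swap) (simp add: power_add sum_distrib_left)
  also have "\<dots> = (\<Sum>x<p. if x = 0 then of_nat p * \<omega> ^ f x else 0)"
    by (intro sum.cong refl) (auto simp: sum_powers dest: dvd_imp_le)
  also have "\<dots> = of_nat p * \<omega> ^ f 0"
    using p_pos by simp
  finally have "(\<Sum>b<p. \<Sum>x<p. \<omega> ^ (f x + b * x)) \<noteq> 0"
    using p_pos nonzero by simp
  then obtain b where b: "b < p" "(\<Sum>x<p. \<omega> ^ (f x + b * x)) \<noteq> 0"
    by (meson lessThan_iff sum.not_neutral_contains_not_neutral)
  have "[f x + b * x = f 0 + b * 0] (mod p)" if "x < p" for x
    using that p_pos b(2) int[of k "k * b" for k]
    by (intro exponents_cong_if_conjugates_divisible[OF \<open>prime p\<close>, of "{..<p}"])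
      (simp_all add: distrib_left mult.assoc)
  with b(1) show ?thesis by (intro that) simp_all
qed

end

section \<open>Perfect isometries of cyclic groups of prime order\<close>

theorem proposition14:
  fixes p :: nat
    and G :: "('a, 'b) monoid_scheme"
    and u :: 'a
    and chi :: "nat \<Rightarrow> 'a \<Rightarrow> complex"
    and f :: "nat \<Rightarrow> nat"
    and I :: "('a \<Rightarrow> complex) \<Rightarrow> ('a \<Rightarrow> complex)"
  assumes "prime p"
    and "group G" and "Coset.order G = p"
    and "u \<in> carrier G" and "carrier G = generate G {u}"
    and "\<And>x. x \<in> {0..<p} \<Longrightarrow> chi x \<in> class_functions G"
    and "\<And>x a :: nat. x \<in> {0..<p} \<Longrightarrow>
           chi x (u [^]\<^bsub>G\<^esub> a) = exp (2 * of_real pi * \<i> / of_nat p) ^ (a * x)"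
    and "bij_betw f {0..<p} {0..<p}"
    and "linear_on_characters G I"
    and "\<And>x. x \<in> {0..<p} \<Longrightarrow> I (chi x) = chi (f x)"
  shows "perfect_isometry p G I \<longleftrightarrow> linear_bijection p f"
proof -
  define \<omega> :: complex where "\<omega> = exp (2 * of_real pi * \<i> / of_nat p)"
  have p1: "p > 1" using \<open>prime p\<close> by (rule prime_gt_1_nat)
  interpret group G by fact
  interpret primitive_root_of_unity p \<omega>
    unfolding \<omega>_def using p1 by (intro primitive_root_of_unity_exp) simp
  interpret cyclic_character_table G p u \<omega> chi
  proof
    show "carrier G = generate G {u}" by fact
  qed (use assms(3,4,6,7) p1 in \<open>simp_all add: \<omega>_def class_functions_def\<close>)
  have f: "bij_betw f {..<p} {..<p}"
    using assms(8) by (simp add: lessThan_atLeast0)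
  have f_less: "f x < p" if "x < p" for x
    using f that by (auto simp: bij_betw_def)
  have I: "I (chi x) = chi (f x)" if "x < p" for x
    using assms(10) that by simp
  note mu = mu_eq[of f I, OF f_less I]
  have one_iff: "u [^]\<^bsub>G\<^esub> k = \<one>\<^bsub>G\<^esub> \<longleftrightarrow> p dvd k" for k :: nat
    by (rule pow_eq_one_iff)
  show ?thesis
  proof
    assume "perfect_isometry p G I"
    then have "algebraic_int (mu G I (u [^]\<^bsub>G\<^esub> a) (u [^]\<^bsub>G\<^esub> b) / of_nat p)" for a b :: nat
      using u_closed by (simp add: perfect_isometry_def)
    then have int: "algebraic_int ((\<Sum>x<p. \<omega> ^ (a * f x + b * x)) / of_nat p)" for a b
      by (simp add: mu)
    obtain b where b: "b < p" "\<And>x. x < p \<Longrightarrow> [f x + b * x = f 0] (mod p)"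
      using affine_if_sums_divisible[OF \<open>prime p\<close>, of f] int by blast
    \<comment> \<open>The slope is \<open>-b\<close>, represented by a natural number below \<open>p\<close>.\<close>
    have "[f x = ((p - b) mod p) * x + f 0] (mod p)" if x: "x < p" for x
    proof -
      have "[f x + b * x + (p - b) * x = f 0 + (p - b) * x] (mod p)"
        by (intro cong_add b(2)[OF x] cong_refl)
      also have "f x + b * x + (p - b) * x = f x + p * x"
        using b(1) by (simp flip: distrib_right add: add.assoc)
      finally have "[f x = f 0 + (p - b) * x] (mod p)"
        by (simp add: cong_def)
      also have "[f 0 + (p - b) * x = ((p - b) mod p) * x + f 0] (mod p)"
        unfolding add.commute[of "f 0"]
        by (intro cong_add cong_mult cong_refl) (simp add: cong_def)
      finally show ?thesis .
    qed
    then show "linear_bijection p f"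
      unfolding linear_bijection_def
      using assms(8) p1 f_less[of 0]
      by (intro conjI bexI[of _ "(p - b) mod p"] bexI[of _ "f 0"]) auto
  next
    assume "linear_bijection p f"
    then obtain \<alpha> \<beta> where "\<alpha> \<in> {0..<p}" and ball: "\<forall>x\<in>{0..<p}. [f x = \<alpha> * x + \<beta>] (mod p)"
      unfolding linear_bijection_def by blast
    then have "\<alpha> < p" and aff: "\<And>x. x < p \<Longrightarrow> [f x = \<alpha> * x + \<beta>] (mod p)"
      by simp_all
    note mu_aff = mu sum_powers_affine[of f \<alpha> \<beta>, OF aff]
    \<comment> \<open>A constant function is not injective on two or more points.\<close>
    have "\<alpha> \<noteq> 0"
    proof
      assume "\<alpha> = 0"
      then have "[f 0 = f 1] (mod p)"
        using aff[of 0] aff[of 1] p1 by (simp add: cong_def)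
      then have "f 0 = f 1"
        using f_less p1 by (simp add: cong_less_modulus_unique_nat)
      then show False
        using f p1 by (auto simp: bij_betw_def inj_on_def)
    qed
    then have "\<not> p dvd \<alpha>" using \<open>\<alpha> < p\<close> by (auto dest: dvd_imp_le)
    show "perfect_isometry p G I"
      unfolding perfect_isometry_def
    proof (intro conjI ballI impI)
      show "character_isometry G I"
        by (rule character_isometry_if_permutes[OF assms(9) f I])
      fix g h assume "g \<in> carrier G" "h \<in> carrier G"
      then obtain a b :: nat where gh: "g = u [^]\<^bsub>G\<^esub> a" "h = u [^]\<^bsub>G\<^esub> b"
        unfolding carrier_eq by blast
      have "algebraic_int \<omega>"
        by (rule algebraic_int_root[of 1 "Polynomial.monom 1 p"]) (use p1 in \<open>auto simp: poly_monom degree_monom_eq\<close>)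
      then show "algebraic_int (mu G I g h / of_nat p)"
        using p1 by (simp add: gh mu_aff algebraic_int_power)
      assume "mu G I g h \<noteq> 0"
      then have dvd: "p dvd a * \<alpha> + b"
        by (simp add: gh mu_aff split: if_splits)
      then have "p dvd a \<longleftrightarrow> p dvd b"
        using \<open>prime p\<close> \<open>\<not> p dvd \<alpha>\<close>
        by (metis dvd_add_right_iff dvd_add_left_iff dvd_mult2 prime_dvd_mult_iff)
      then show "g = \<one>\<^bsub>G\<^esub> \<longleftrightarrow> h = \<one>\<^bsub>G\<^esub>"
        by (simp add: gh one_iff)
    qed
  qed
qed

end
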